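(* Let $M$ be a finite monoid, let $N$ be a submonoid of $M$, and let $x,y\in M$. Then $x\,\mathscr{J}^{M,N}\,y$ if and only if $R_x^{M,N}$ and $R_y^{M,N}$ belong to the same strongly connected component of the action of $N$ on the $\mathscr{R}^{M,N}$-classes of $M$ by left multiplication.
   Context: Submonoids have the same identity as the containing monoid. For $x,y\in M$: $x\,\mathscr{R}^{M,N}\,y$ iff $xN=yN$, where $xN=\{xn:n\in N\}$; $x\,\mathscr{J}^{M,N}\,y$ iff $NxN=NyN$, where $NxN=\{nxn':n,n'\in N\}$. $R_x^{M,N}$ denotes the $\mathscr{R}^{M,N}$-class of $x$. Since $\mathscr{R}^{M,N}$ is invariant under left multiplication, $N$ acts on the left on the set of $\mathscr{R}^{M,N}$-classes by $n\cdot R_x^{M,N}=R_{nx}^{M,N}$. Two classes $R_x^{M,N},R_y^{M,N}$ are in the same strongly connected component of this action if there exist $s,t\in N$ with $s\cdot R_x^{M,N}=R_y^{M,N}$ and $t\cdot R_y^{M,N}=R_x^{M,N}$. *)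

theory Defs
  imports "HOL-Algebra.Coset"
begin

definition two_sided_set :: "('a, 'b) monoid_scheme \<Rightarrow> 'a set \<Rightarrow> 'a \<Rightarrow> 'a set" where
  "two_sided_set M N x = {n \<otimes>\<^bsub>M\<^esub> x \<otimes>\<^bsub>M\<^esub> n' | n n'. n \<in> N \<and> n' \<in> N}"

definition rel_R :: "('a, 'b) monoid_scheme \<Rightarrow> 'a set \<Rightarrow> ('a \<times> 'a) set" where
  "rel_R M N = {(x, y). x \<in> carrier M \<and> y \<in> carrier M \<and> x <#\<^bsub>M\<^esub> N = y <#\<^bsub>M\<^esub> N}"

definition rel_J :: "('a, 'b) monoid_scheme \<Rightarrow> 'a set \<Rightarrow> ('a \<times> 'a) set" where
  "rel_J M N = {(x, y). x \<in> carrier M \<and> y \<in> carrier M \<and>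
     two_sided_set M N x = two_sided_set M N y}"

definition R_class :: "('a, 'b) monoid_scheme \<Rightarrow> 'a set \<Rightarrow> 'a \<Rightarrow> 'a set" where
  "R_class M N x = rel_R M N `` {x}"

text \<open>The left action of \<open>N\<close> on the set \<open>carrier M // rel_R M N\<close> of classes. All members of the
  union coincide when \<open>C\<close> is a class, so that \<open>n\<close> takes the class of \<open>x\<close> to the class of \<open>n x\<close>:
  see \<open>R_act_R_class\<close> below.\<close>

definition R_act :: "('a, 'b) monoid_scheme \<Rightarrow> 'a set \<Rightarrow> 'a \<Rightarrow> 'a set \<Rightarrow> 'a set" where
  "R_act M N n C = (\<Union>c\<in>C. R_class M N (n \<otimes>\<^bsub>M\<^esub> c))"

definition same_strong_component ::
    "('a, 'b) monoid_scheme \<Rightarrow> 'a set \<Rightarrow> 'a set \<Rightarrow> 'a set \<Rightarrow> bool" where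
  "same_strong_component M N C D \<longleftrightarrow>
     C \<in> carrier M // rel_R M N \<and> D \<in> carrier M // rel_R M N \<and>
     (\<exists>s\<in>N. \<exists>t\<in>N. R_act M N s C = D \<and> R_act M N t D = C)"

lemma equiv_rel_R: "equiv (carrier M) (rel_R M N)"
  by (rule equivI) (auto simp: rel_R_def refl_on_def sym_on_def trans_on_def)

lemma R_class_in_quotient: "x \<in> carrier M \<Longrightarrow> R_class M N x \<in> carrier M // rel_R M N"
  unfolding R_class_def by (rule quotientI)

lemma rel_R_left_mult:
  assumes "monoid M" "submonoid N M" "n \<in> carrier M" "(x, y) \<in> rel_R M N"
  shows "(n \<otimes>\<^bsub>M\<^esub> x, n \<otimes>\<^bsub>M\<^esub> y) \<in> rel_R M N"
proof -
  interpret monoid M by fact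
  interpret submonoid N M by fact
  have xy: "x \<in> carrier M" "y \<in> carrier M" "x <#\<^bsub>M\<^esub> N = y <#\<^bsub>M\<^esub> N"
    using assms(4) by (auto simp: rel_R_def)
  have "(n \<otimes>\<^bsub>M\<^esub> z) <#\<^bsub>M\<^esub> N = (\<lambda>w. n \<otimes>\<^bsub>M\<^esub> w) ` (z <#\<^bsub>M\<^esub> N)" if "z \<in> carrier M" for z
    using that assms(3) by (auto simp: l_coset_def m_assoc)
  then show ?thesis
    using xy assms(3) by (simp add: rel_R_def)
qed

lemma R_act_R_class:
  assumes "monoid M" "submonoid N M" "n \<in> N" "x \<in> carrier M"
  shows "R_act M N n (R_class M N x) = R_class M N (n \<otimes>\<^bsub>M\<^esub> x)"
proof -
  have n: "n \<in> carrier M"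
    using assms(2,3) by (rule submonoid.mem_carrier)
  have "R_class M N (n \<otimes>\<^bsub>M\<^esub> c) = R_class M N (n \<otimes>\<^bsub>M\<^esub> x)" if "c \<in> R_class M N x" for c
    using rel_R_left_mult[OF assms(1,2) n] that equiv_class_eq[OF equiv_rel_R]
    unfolding R_class_def by (metis Image_singleton_iff)
  moreover have "x \<in> R_class M N x"
    unfolding R_class_def using equiv_class_self[OF equiv_rel_R assms(4)] .
  ultimately show ?thesis
    unfolding R_act_def by blast
qed

end

theory Submission
  imports Defs
begin

text \<open>
  Unfolding the action, the strong component condition says that \<open>s x N = y N\<close> and
  \<open>t y N = x N\<close> for some \<open>s, t \<in> N\<close>. From \<open>s x N = y N\<close> one gets \<open>N y N = N s x N \<subseteq> N x N\<close>, so
  these two equations give \<open>N x N = N y N\<close>.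

  Conversely, \<open>N x N = N y N\<close> gives \<open>y = a x b\<close> and \<open>x = c y d\<close> with \<open>a, b, c, d \<in> N\<close>, hence only
  the inclusions \<open>y N \<subseteq> a x N\<close> and \<open>x N \<subseteq> c y N\<close>. Finiteness makes them equalities: left
  multiplication cannot enlarge a coset, so
  \<open>|y N| \<le> |a x N| \<le> |x N| \<le> |c y N| \<le> |y N|\<close>,
  and all these numbers agree. Thus the left factors \<open>a\<close> and \<open>c\<close> themselves serve as \<open>s\<close> and \<open>t\<close>
  (lemma \<open>rel_J_imp_l_coset_eq\<close>).
\<close>

lemma R_class_eq_iff:
  assumes "x \<in> carrier M" "y \<in> carrier M"
  shows "R_class M N x = R_class M N y \<longleftrightarrow> x <#\<^bsub>M\<^esub> N = y <#\<^bsub>M\<^esub> N"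
  using eq_equiv_class_iff[OF equiv_rel_R assms, of N] assms
  by (auto simp: R_class_def rel_R_def)

lemma same_strong_component_R_class_iff:
  assumes "monoid M" "submonoid N M" "x \<in> carrier M" "y \<in> carrier M"
  shows "same_strong_component M N (R_class M N x) (R_class M N y) \<longleftrightarrow>
    (\<exists>s\<in>N. (s \<otimes>\<^bsub>M\<^esub> x) <#\<^bsub>M\<^esub> N = y <#\<^bsub>M\<^esub> N) \<and> (\<exists>t\<in>N. (t \<otimes>\<^bsub>M\<^esub> y) <#\<^bsub>M\<^esub> N = x <#\<^bsub>M\<^esub> N)"
proof -
  interpret monoid M by fact
  interpret submonoid N M by fact
  have "R_act M N n (R_class M N u) = R_class M N v \<longleftrightarrow> (n \<otimes>\<^bsub>M\<^esub> u) <#\<^bsub>M\<^esub> N = v <#\<^bsub>M\<^esub> N"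
    if "n \<in> N" "u \<in> carrier M" "v \<in> carrier M" for n u v
    using that by (simp add: R_act_R_class[OF assms(1,2)] R_class_eq_iff)
  then show ?thesis
    using assms(3,4) R_class_in_quotient[of _ M N]
    unfolding same_strong_component_def by blast
qed

lemma two_sided_set_eq_UN_l_coset:
  "two_sided_set M N x = (\<Union>n\<in>N. (n \<otimes>\<^bsub>M\<^esub> x) <#\<^bsub>M\<^esub> N)"
  by (auto simp: two_sided_set_def l_coset_def)

lemma l_coset_mult_left:
  assumes "monoid M" "N \<subseteq> carrier M" "n \<in> carrier M" "x \<in> carrier M"
  shows "(n \<otimes>\<^bsub>M\<^esub> x) <#\<^bsub>M\<^esub> N = (\<lambda>w. n \<otimes>\<^bsub>M\<^esub> w) ` (x <#\<^bsub>M\<^esub> N)"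
  using assms by (auto simp: l_coset_def monoid.m_assoc subset_iff)

lemma card_l_coset_mult_left_le:
  assumes "monoid M" "finite N" "N \<subseteq> carrier M" "n \<in> carrier M" "x \<in> carrier M"
  shows "card ((n \<otimes>\<^bsub>M\<^esub> x) <#\<^bsub>M\<^esub> N) \<le> card (x <#\<^bsub>M\<^esub> N)"
proof -
  have "finite (x <#\<^bsub>M\<^esub> N)"
    using assms(2) by (simp add: l_coset_def)
  then show ?thesis
    using assms by (simp add: l_coset_mult_left card_image_le)
qed

lemma two_sided_set_mono:
  assumes "monoid M" "submonoid N M" "x \<in> carrier M" "y \<in> carrier M"
    and s: "s \<in> N" "(s \<otimes>\<^bsub>M\<^esub> x) <#\<^bsub>M\<^esub> N = y <#\<^bsub>M\<^esub> N"
  shows "two_sided_set M N y \<subseteq> two_sided_set M N x"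
proof -
  interpret monoid M by fact
  interpret submonoid N M by fact
  have "(n \<otimes>\<^bsub>M\<^esub> y) <#\<^bsub>M\<^esub> N = ((n \<otimes>\<^bsub>M\<^esub> s) \<otimes>\<^bsub>M\<^esub> x) <#\<^bsub>M\<^esub> N" if n: "n \<in> N" for n
  proof -
    have "(n \<otimes>\<^bsub>M\<^esub> y) <#\<^bsub>M\<^esub> N = (n \<otimes>\<^bsub>M\<^esub> (s \<otimes>\<^bsub>M\<^esub> x)) <#\<^bsub>M\<^esub> N"
      using n s assms(3,4) subset by (simp add: l_coset_mult_left[OF assms(1)])
    then show ?thesis
      using n s(1) assms(3) by (simp add: m_assoc)
  qed
  then show ?thesis
    using s(1) by (auto simp: two_sided_set_eq_UN_l_coset)
qed

lemma two_sided_set_memE: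
  assumes "monoid M" "submonoid N M" "x \<in> carrier M"
    and "y \<in> two_sided_set M N x"
  obtains a where "a \<in> N" "y <#\<^bsub>M\<^esub> N \<subseteq> (a \<otimes>\<^bsub>M\<^esub> x) <#\<^bsub>M\<^esub> N"
proof -
  interpret monoid M by fact
  interpret submonoid N M by fact
  obtain a b where ab: "a \<in> N" "b \<in> N" "y = a \<otimes>\<^bsub>M\<^esub> x \<otimes>\<^bsub>M\<^esub> b"
    using assms(4) by (auto simp: two_sided_set_def)
  have "y \<otimes>\<^bsub>M\<^esub> n = a \<otimes>\<^bsub>M\<^esub> x \<otimes>\<^bsub>M\<^esub> (b \<otimes>\<^bsub>M\<^esub> n)" if "n \<in> N" for n
    using that ab assms(3) by (simp add: m_assoc)
  then have "y <#\<^bsub>M\<^esub> N \<subseteq> (a \<otimes>\<^bsub>M\<^esub> x) <#\<^bsub>M\<^esub> N"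
    using ab(2) by (auto simp: l_coset_def)
  with ab(1) show ?thesis by (rule that)
qed

lemma self_mem_two_sided_set:
  assumes "monoid M" "submonoid N M" "x \<in> carrier M"
  shows "x \<in> two_sided_set M N x"
proof -
  interpret monoid M by fact
  interpret submonoid N M by fact
  have "x = \<one>\<^bsub>M\<^esub> \<otimes>\<^bsub>M\<^esub> x \<otimes>\<^bsub>M\<^esub> \<one>\<^bsub>M\<^esub>"
    using assms(3) by simp
  then show ?thesis
    unfolding two_sided_set_def using one_closed by blast
qed

text \<open>This is where finiteness enters: the cyclic chain of cardinalities forces the inclusion
  \<open>y N \<subseteq> a x N\<close> to be an equality. Only one of the two equations is stated, because the
  other one follows by exchanging \<open>x\<close> and \<open>y\<close>.\<close>

lemma rel_J_imp_l_coset_eq: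
  assumes "monoid M" "submonoid N M" "finite N" "(x, y) \<in> rel_J M N"
  shows "\<exists>s\<in>N. (s \<otimes>\<^bsub>M\<^esub> x) <#\<^bsub>M\<^esub> N = y <#\<^bsub>M\<^esub> N"
proof -
  interpret monoid M by fact
  interpret submonoid N M by fact
  have xy: "x \<in> carrier M" "y \<in> carrier M" "two_sided_set M N x = two_sided_set M N y"
    using assms(4) by (auto simp: rel_J_def)
  have "y \<in> two_sided_set M N x" "x \<in> two_sided_set M N y"
    using xy self_mem_two_sided_set[OF assms(1,2)] by auto
  then obtain a c where a: "a \<in> N" "y <#\<^bsub>M\<^esub> N \<subseteq> (a \<otimes>\<^bsub>M\<^esub> x) <#\<^bsub>M\<^esub> N"
    and c: "c \<in> N" "x <#\<^bsub>M\<^esub> N \<subseteq> (c \<otimes>\<^bsub>M\<^esub> y) <#\<^bsub>M\<^esub> N"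
    using xy(1,2) two_sided_set_memE[OF assms(1,2)] by metis
  have fin: "finite (z <#\<^bsub>M\<^esub> N)" for z
    using assms(3) by (simp add: l_coset_def)
  have "card ((a \<otimes>\<^bsub>M\<^esub> x) <#\<^bsub>M\<^esub> N) \<le> card (x <#\<^bsub>M\<^esub> N)"
    using a(1) xy(1) by (intro card_l_coset_mult_left_le assms subset) auto
  also have "\<dots> \<le> card ((c \<otimes>\<^bsub>M\<^esub> y) <#\<^bsub>M\<^esub> N)"
    using c(2) fin by (rule card_mono[rotated])
  also have "\<dots> \<le> card (y <#\<^bsub>M\<^esub> N)"
    using c(1) xy(2) by (intro card_l_coset_mult_left_le assms subset) auto
  finally have "y <#\<^bsub>M\<^esub> N = (a \<otimes>\<^bsub>M\<^esub> x) <#\<^bsub>M\<^esub> N"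
    using a(2) fin by (intro card_seteq)
  with a(1) show ?thesis by metis
qed

theorem proposition7p9:
  fixes M :: "('a, 'b) monoid_scheme" and N :: "'a set" and x y :: 'a
  assumes "monoid M" and "finite (carrier M)"
    and "submonoid N M"
    and "x \<in> carrier M" and "y \<in> carrier M"
  shows "(x, y) \<in> rel_J M N \<longleftrightarrow>
    same_strong_component M N (R_class M N x) (R_class M N y)"
proof
  assume J: "(x, y) \<in> rel_J M N"
  then have "(y, x) \<in> rel_J M N"
    by (simp add: rel_J_def)
  moreover have "finite N"
    using assms(2) submonoid.subset[OF assms(3)] by (rule finite_subset[rotated])
  ultimately show "same_strong_component M N (R_class M N x) (R_class M N y)"
    using J assms by (simp add: same_strong_component_R_class_iff rel_J_imp_l_coset_eq)
next
  assume "same_strong_component M N (R_class M N x) (R_class M N y)"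
  then have "two_sided_set M N x = two_sided_set M N y"
    using two_sided_set_mono[OF assms(1,3)] assms(4,5)
    unfolding same_strong_component_R_class_iff[OF assms(1,3-5)] by blast
  with assms(4,5) show "(x, y) \<in> rel_J M N"
    by (simp add: rel_J_def)
qed

end
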